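(* Let $A\in\mathbb{R}^{m\times n}$ have full row rank, $B\in\mathbb{R}^{p\times n}$, $b\in\mathbb{R}^m$, let $f(x)=\tfrac12x^THx+\zeta^Tx$ with $H\in\mathbb{S}_{+}^n$ and $\zeta\in\mathbb{R}^n$, and let $h=I_{Ax=b}$. Assume that $x^THx>0$ whenever $x\ne0$ and $Ax=0$, i.e. that $H$ is positive definite on the null-space of $A$. Put $C=[A^T~B^T]^T\in\mathbb{R}^{(m+p)\times n}$, $c=(b,0)\in\mathbb{R}^{m+p}$, $F=f+h$, $d(\nu)=-F^\star(-C^T\nu)-c^T\nu$ for $\nu\in\mathbb{R}^{m+p}$, and $$\begin{bmatrix} K_{11} & K_{12} \\ K_{21} & K_{22} \end{bmatrix}=\begin{bmatrix} H & A^T \\ A & 0 \end{bmatrix}^{-1},\qquad K_{11}\in\mathbb{R}^{n\times n}.$$ Then for all $\mathbf{L}\in\mathbb{S}_+^{m+p}$ such that $\mathbf{L}\succeq CK_{11}C^T$, the inequality $$d(\nu_1)\ge d(\nu_2)+\langle\nabla d(\nu_2),\nu_1-\nu_2\rangle-\tfrac12\|\nu_1-\nu_2\|_{\mathbf{L}}^2$$ holds for every $\nu_1,\nu_2\in\mathbb{R}^{m+p}$. Further, for any symmetric matrix $\mathbf{L}\in\mathbb{R}^{(m+p)\times(m+p)}$ with $\mathbf{L}\not\succeq CK_{11}C^T$ there exist $\nu_1,\nu_2\in\mathbb{R}^{m+p}$ such that this inequality does not hold.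
   Context: $\mathbb{S}_+^k$ is the set of symmetric positive semidefinite real $k\times k$ matrices; $L\succeq M$ means $L-M$ is symmetric positive semidefinite, and $\not\succeq$ is its negation; $\|v\|_{\mathbf{L}}^2:=v^T\mathbf{L}v$. $I_{Ax=b}$ is the indicator function of $\{x\in\mathbb{R}^n: Ax=b\}$ (value $0$ on the set, $\infty$ elsewhere). The conjugate of $F$ is $F^\star(y)=\sup_x\{y^Tx-F(x)\}$. Under the stated assumptions the block matrix $\begin{bmatrix} H & A^T \\ A & 0 \end{bmatrix}$ is invertible and $d$ is finite and differentiable on $\mathbb{R}^{m+p}$. *)

theory Defs
  imports "HOL-Analysis.Analysis"
begin

(* Concatenation of vectors. As a matrix is a vector of rows, vcat A B is also the
   matrix with A on top of B, that is, [A^T B^T]^T. *)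
definition vcat :: "'a ^ 'm \<Rightarrow> 'a ^ 'p \<Rightarrow> 'a ^ ('m + 'p)" where
  "vcat u v = (\<chi> i. case i of Inl j \<Rightarrow> u $ j | Inr k \<Rightarrow> v $ k)"

definition hcat :: "'a ^ 'n ^ 'k \<Rightarrow> 'a ^ 'm ^ 'k \<Rightarrow> 'a ^ ('n + 'm) ^ 'k" where
  "hcat P Q = (\<chi> i. vcat (P $ i) (Q $ i))"

definition block_matrix ::
  "'a ^ 'n ^ 'k \<Rightarrow> 'a ^ 'm ^ 'k \<Rightarrow> 'a ^ 'n ^ 'l \<Rightarrow> 'a ^ 'm ^ 'l \<Rightarrow> 'a ^ ('n + 'm) ^ ('k + 'l)" where
  "block_matrix P Q R S = vcat (hcat P Q) (hcat R S)"

definition block11 :: "'a ^ ('n::finite + 'm::finite) ^ ('k::finite + 'l::finite) \<Rightarrow> 'a ^ 'n ^ 'k" where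
  "block11 K = (\<chi> i j. K $ Inl i $ Inl j)"

definition symmetric_matrix :: "real ^ 'k ^ 'k \<Rightarrow> bool" where
  "symmetric_matrix M \<longleftrightarrow> transpose M = M"

definition pos_semidef :: "real ^ 'k ^ 'k \<Rightarrow> bool" where
  "pos_semidef M \<longleftrightarrow> symmetric_matrix M \<and> (\<forall>v. 0 \<le> v \<bullet> (M *v v))"

definition loewner_ge :: "real ^ 'k ^ 'k \<Rightarrow> real ^ 'k ^ 'k \<Rightarrow> bool" (infix "\<succeq>" 50) where
  "L \<succeq> M \<longleftrightarrow> pos_semidef (L - M)"

definition weighted_norm_sq :: "real ^ 'k ^ 'k \<Rightarrow> real ^ 'k \<Rightarrow> real" where
  "weighted_norm_sq L v = v \<bullet> (L *v v)"

definition indicator_fn :: "'a set \<Rightarrow> 'a \<Rightarrow> ereal" where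
  "indicator_fn S x = (if x \<in> S then 0 else \<infinity>)"

definition conjugate :: "('a::real_inner \<Rightarrow> ereal) \<Rightarrow> 'a \<Rightarrow> ereal" where
  "conjugate F y = (SUP x. ereal (y \<bullet> x) - F x)"

(* Differentiability of an extended-real-valued function at x includes finiteness near x,
   so the value of real_of_ereal at infinity plays no role. *)
definition has_gradient :: "('a::real_inner \<Rightarrow> ereal) \<Rightarrow> 'a \<Rightarrow> 'a \<Rightarrow> bool" where
  "has_gradient g x D \<longleftrightarrow>
     (\<forall>\<^sub>F y in nhds x. \<bar>g y\<bar> \<noteq> \<infinity>) \<and> (GDERIV (\<lambda>y. real_of_ereal (g y)) x :> D)"

definition gradient :: "('a::real_inner \<Rightarrow> ereal) \<Rightarrow> 'a \<Rightarrow> 'a" where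
  "gradient g x = (THE D. has_gradient g x D)"

end

theory Submission
  imports Defs
begin

text \<open>
  The function \<open>F\<close> is a quadratic restricted to the affine space \<open>A x = b\<close>, so its conjugate is
  again a quadratic, and \<open>d\<close> equals each of its second-order Taylor polynomials. The
  supremum defining \<open>conjugate F y\<close> is attained at the first component of the solution
  \<open>(x, \<lambda>)\<close> of the KKT system \<open>H x + A\<^sup>T \<lambda> = y - \<zeta>\<close>, \<open>A x = b\<close> (\<open>conjugate_eq_at_KKT_point\<close>).
  Changing \<open>y\<close> to \<open>y + e\<close> moves that point by \<open>z = K11 e\<close>, and since \<open>z \<bullet> H z = z \<bullet> e\<close> this gives
  the exact expansion \<open>F\<^sup>\<star>(y + e) = F\<^sup>\<star>(y) + x \<bullet> e + e \<bullet> K11 e / 2\<close>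
  (\<open>conjugate_exact_expansion\<close>).

  Substituting \<open>y = - C\<^sup>T \<nu>\<close> shows that \<open>d \<nu>1\<close> equals
  \<open>d \<nu>2 + \<nabla>d \<nu>2 \<bullet> (\<nu>1 - \<nu>2) - \<parallel>\<nu>1 - \<nu>2\<parallel>\<^sup>2 / 2\<close>, the norm being weighted by \<open>G = C K11 C\<^sup>T\<close>. The
  inequality for \<open>L\<close> at \<open>\<nu>1, \<nu>2\<close> therefore says exactly that \<open>L - G\<close> is nonnegative at
  \<open>\<nu>1 - \<nu>2\<close>, an arbitrary vector. Both halves of the theorem follow; the second also
  uses the symmetry of \<open>G\<close>, without which \<open>L \<succeq> G\<close> could fail for a reason that the inequality
  does not see.
\<close>

section \<open>Block vectors, block matrices and symmetry\<close>

lemma exists_vcat: "\<exists>u v. w = vcat u v"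
  by (rule exI[of _ "\<chi> i. w $ Inl i"], rule exI[of _ "\<chi> i. w $ Inr i"])
    (auto simp: vcat_def vec_eq_iff split: sum.split)

lemma vcat_eq_iff [simp]: "vcat u v = vcat u' v' \<longleftrightarrow> u = u' \<and> v = v'"
proof
  assume eq: "vcat u v = vcat u' v'"
  have "vcat u v $ Inl i = vcat u' v' $ Inl i" "vcat u v $ Inr j = vcat u' v' $ Inr j" for i j
    by (simp_all only: eq)
  then show "u = u' \<and> v = v'" by (simp add: vcat_def vec_eq_iff)
qed simp

lemma vcat_0_0 [simp]: "vcat 0 0 = 0"
  by (simp add: vcat_def vec_eq_iff split: sum.split)

lemma sum_UNIV_sum_type:
  fixes g :: "'a::finite + 'b::finite \<Rightarrow> 'c::comm_monoid_add"
  shows "sum g UNIV = (\<Sum>i\<in>UNIV. g (Inl i)) + (\<Sum>j\<in>UNIV. g (Inr j))"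
  by (simp flip: UNIV_Plus_UNIV add: sum.Plus)

lemma block_matrix_mult_vcat:
  fixes P :: "real ^ 'n ^ 'k" and Q :: "real ^ 'm ^ 'k"
    and R :: "real ^ 'n ^ 'l" and S :: "real ^ 'm ^ 'l"
  shows "block_matrix P Q R S *v vcat u v = vcat (P *v u + Q *v v) (R *v u + S *v v)"
  by (auto simp: vec_eq_iff block_matrix_def hcat_def vcat_def matrix_vector_mult_def
      sum_UNIV_sum_type split: sum.split)

lemma block11_mult:
  fixes K :: "real ^ ('n::finite + 'm::finite) ^ ('k::finite + 'l::finite)"
  assumes "K *v vcat e 0 = vcat u v"
  shows "block11 K *v e = u"
proof -
  have "(K *v vcat e 0) $ Inl i = vcat u v $ Inl i" for i
    by (simp only: assms)
  then show ?thesis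
    by (simp add: vec_eq_iff block11_def vcat_def matrix_vector_mult_def sum_UNIV_sum_type)
qed

lemma invertible_matrix_inv_right:
  fixes M :: "real ^ 'n ^ 'n"
  assumes "invertible M"
  shows "M ** matrix_inv M = mat 1"
  using assms unfolding invertible_def matrix_inv_def by (metis (mono_tags, lifting) someI_ex)

lemma inner_row_space_kernel:
  fixes A :: "real ^ 'n ^ 'm"
  assumes "A *v z = 0"
  shows "(l v* A) \<bullet> z = 0"
  by (simp add: dot_lmul_matrix assms)

lemma symmetric_matrix_iff_inner:
  fixes M :: "real ^ 'k ^ 'k"
  shows "symmetric_matrix M \<longleftrightarrow> (\<forall>u v. (M *v u) \<bullet> v = u \<bullet> (M *v v))"
proof
  assume "symmetric_matrix M"
  then show "\<forall>u v. (M *v u) \<bullet> v = u \<bullet> (M *v v)"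
    by (metis dot_lmul_matrix symmetric_matrix_def transpose_matrix_vector)
next
  assume adj: "\<forall>u v. (M *v u) \<bullet> v = u \<bullet> (M *v v)"
  have "transpose M *v v = M *v v" for v
    by (metis adj dot_lmul_matrix inner_commute transpose_matrix_vector vector_eq_ldot)
  then show "symmetric_matrix M"
    by (simp add: symmetric_matrix_def matrix_eq)
qed

section \<open>The KKT matrix and its inverse\<close>

text \<open>
  In the kernel of the KKT matrix, \<open>H x + A\<^sup>T \<lambda> = 0\<close> and \<open>A x = 0\<close> give \<open>x \<bullet> H x = 0\<close>, hence \<open>x = 0\<close>,
  and then \<open>\<lambda> = 0\<close> because the rows of \<open>A\<close> are independent.
\<close>
lemma KKT_matrix_invertible:
  fixes A :: "real ^ 'n ^ 'm" and H :: "real ^ 'n ^ 'n"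
  assumes A_rank: "rank A = CARD('m)"
    and H_pd: "\<And>x. x \<noteq> 0 \<Longrightarrow> A *v x = 0 \<Longrightarrow> x \<bullet> (H *v x) > 0"
  shows "invertible (block_matrix H (transpose A) A 0)"
proof -
  let ?M = "block_matrix H (transpose A) A 0"
  have "w = 0" if w: "?M *v w = 0" for w
  proof -
    obtain x l where xl: "w = vcat x l"
      using exists_vcat by blast
    have "vcat (H *v x + transpose A *v l) (A *v x) = vcat 0 0"
      using w by (simp add: xl block_matrix_mult_vcat)
    then have stat: "H *v x + transpose A *v l = 0" and feas: "A *v x = 0"
      by (simp_all only: vcat_eq_iff)
    have "x \<bullet> (H *v x) = x \<bullet> (H *v x + transpose A *v l)"
      by (simp add: inner_add_right inner_commute[of x "l v* A"]
          inner_row_space_kernel[OF feas])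
    also have "\<dots> = 0" by (simp only: stat inner_zero_right)
    finally have "x = 0" using H_pd[OF _ feas] by force
    moreover have "l = 0"
    proof -
      have "rank (transpose A) = CARD('m)"
        using A_rank by (simp only: rank_transpose)
      then have "inj ((*v) (transpose A))"
        by (simp only: full_rank_injective)
      moreover have "transpose A *v l = transpose A *v 0"
        using stat by (simp only: \<open>x = 0\<close> matrix_vector_mult_0_right add_0_left)
      ultimately show ?thesis by (rule injD)
    qed
    ultimately show ?thesis by (simp add: xl)
  qed
  then show ?thesis
    by (simp add: invertible_left_inverse matrix_left_invertible_ker)
qed

text \<open>
  The two equations say that \<open>K11 e\<close> is the first component of the solution of the KKT system with
  right-hand side \<open>(e, 0)\<close>. Everything else about \<open>K11\<close> is derived from this.
\<close>
lemma block11_KKT_inverse: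
  fixes A :: "real ^ 'n ^ 'm" and H :: "real ^ 'n ^ 'n"
  assumes inv: "invertible (block_matrix H (transpose A) A 0)"
    and K11: "K11 = block11 (matrix_inv (block_matrix H (transpose A) A 0))"
  shows "\<exists>\<mu>. H *v (K11 *v e) + transpose A *v \<mu> = e" and "A *v (K11 *v e) = 0"
proof -
  let ?M = "block_matrix H (transpose A) A 0"
  obtain z \<mu> where z: "matrix_inv ?M *v vcat e 0 = vcat z \<mu>"
    using exists_vcat by blast
  have "?M *v vcat z \<mu> = vcat e 0"
    by (simp add: matrix_vector_mul_assoc invertible_matrix_inv_right[OF inv] flip: z)
  then have "H *v z + transpose A *v \<mu> = e" "A *v z = 0"
    by (simp_all add: block_matrix_mult_vcat)
  moreover have "K11 *v e = z"
    using block11_mult[OF z] K11 by simp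
  ultimately show "\<exists>\<mu>. H *v (K11 *v e) + transpose A *v \<mu> = e" "A *v (K11 *v e) = 0"
    by auto
qed

lemma block11_KKT_inverse_form:
  fixes A :: "real ^ 'n ^ 'm" and H :: "real ^ 'n ^ 'n"
  assumes "invertible (block_matrix H (transpose A) A 0)"
    and "K11 = block11 (matrix_inv (block_matrix H (transpose A) A 0))"
  shows "(H *v (K11 *v e)) \<bullet> (K11 *v e') = e \<bullet> (K11 *v e')"
proof -
  obtain \<mu> where "H *v (K11 *v e) + transpose A *v \<mu> = e"
    using block11_KKT_inverse(1)[OF assms] by blast
  then have "e \<bullet> (K11 *v e') = (H *v (K11 *v e) + transpose A *v \<mu>) \<bullet> (K11 *v e')"
    by simp
  then show ?thesis
    by (simp add: inner_add_left inner_row_space_kernel block11_KKT_inverse(2)[OF assms])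
qed

lemma block11_KKT_inverse_symmetric:
  fixes A :: "real ^ 'n ^ 'm" and H :: "real ^ 'n ^ 'n"
  assumes H_sym: "symmetric_matrix H"
    and K: "invertible (block_matrix H (transpose A) A 0)"
      "K11 = block11 (matrix_inv (block_matrix H (transpose A) A 0))"
  shows "symmetric_matrix K11"
  unfolding symmetric_matrix_iff_inner
proof (intro allI)
  fix u v
  have "u \<bullet> (K11 *v v) = (H *v (K11 *v u)) \<bullet> (K11 *v v)"
    by (simp add: block11_KKT_inverse_form[OF K])
  also have "\<dots> = (K11 *v u) \<bullet> (H *v (K11 *v v))"
    using H_sym by (simp add: symmetric_matrix_iff_inner)
  also have "\<dots> = v \<bullet> (K11 *v u)"
    by (simp add: block11_KKT_inverse_form[OF K] inner_commute[of "K11 *v u"])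
  finally show "(K11 *v u) \<bullet> v = u \<bullet> (K11 *v v)"
    by (simp add: inner_commute)
qed

lemma KKT_point_exists:
  fixes A :: "real ^ 'n ^ 'm" and H :: "real ^ 'n ^ 'n"
  assumes "invertible (block_matrix H (transpose A) A 0)"
  shows "\<exists>x l. H *v x + \<zeta> + transpose A *v l = y \<and> A *v x = b"
proof -
  let ?M = "block_matrix H (transpose A) A 0"
  obtain x l where xl: "matrix_inv ?M *v vcat (y - \<zeta>) b = vcat x l"
    using exists_vcat by blast
  have "?M *v vcat x l = vcat (y - \<zeta>) b"
    by (simp add: matrix_vector_mul_assoc invertible_matrix_inv_right[OF assms] flip: xl)
  then have "H *v x + transpose A *v l = y - \<zeta>" "A *v x = b"
    by (simp_all add: block_matrix_mult_vcat)
  then show ?thesis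
    by (intro exI[of _ x] exI[of _ l]) (simp add: algebra_simps)
qed

section \<open>The conjugate of a quadratic on an affine space\<close>

lemma quadratic_add:
  fixes H :: "real ^ 'n ^ 'n"
  assumes "symmetric_matrix H"
  shows "1/2 * ((x + z) \<bullet> (H *v (x + z))) + \<zeta> \<bullet> (x + z)
    = 1/2 * (x \<bullet> (H *v x)) + \<zeta> \<bullet> x + (H *v x + \<zeta>) \<bullet> z + 1/2 * (z \<bullet> (H *v z))"
proof -
  have "x \<bullet> (H *v z) = (H *v x) \<bullet> z"
    using assms by (simp add: symmetric_matrix_iff_inner)
  then show ?thesis
    by (simp add: matrix_vector_right_distrib inner_add_left inner_add_right
        inner_commute[of z "H *v x"])
qed

text \<open>
  A feasible step \<open>z\<close> from a KKT point changes \<open>y \<bullet> x - f x\<close> by \<open>(A\<^sup>T \<lambda>) \<bullet> z - z \<bullet> H z / 2\<close>. The linear term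
  vanishes because \<open>A z = 0\<close>, so the KKT point attains the supremum.
\<close>
lemma conjugate_eq_at_KKT_point:
  fixes A :: "real ^ 'n ^ 'm" and H :: "real ^ 'n ^ 'n"
  assumes H_psd: "pos_semidef H"
    and f: "f = (\<lambda>x. 1/2 * (x \<bullet> (H *v x)) + \<zeta> \<bullet> x)"
    and stat: "H *v x + \<zeta> + transpose A *v l = y"
    and feas: "A *v x = b"
  shows "conjugate (\<lambda>x. ereal (f x) + indicator_fn {x. A *v x = b} x) y = ereal (y \<bullet> x - f x)"
  unfolding conjugate_def
proof (rule antisym[OF SUP_least])
  fix w
  show "ereal (y \<bullet> w) - (ereal (f w) + indicator_fn {x. A *v x = b} w) \<le> ereal (y \<bullet> x - f x)"
  proof (cases "A *v w = b")
    case True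
    define z where "z = w - x"
    have w: "w = x + z" by (simp add: z_def)
    have Az: "A *v z = 0"
      using True feas by (simp add: z_def matrix_vector_mult_diff_distrib)
    have "y \<bullet> z = (H *v x + \<zeta>) \<bullet> z"
      by (simp add: inner_add_left inner_row_space_kernel[OF Az] flip: stat)
    moreover have "f w = f x + (H *v x + \<zeta>) \<bullet> z + 1/2 * (z \<bullet> (H *v z))"
      unfolding f w using H_psd by (intro quadratic_add) (simp add: pos_semidef_def)
    moreover have "0 \<le> z \<bullet> (H *v z)"
      using H_psd by (simp add: pos_semidef_def)
    ultimately have "y \<bullet> w - f w \<le> y \<bullet> x - f x"
      by (simp add: w inner_add_right)
    then show ?thesis using True by (simp add: indicator_fn_def)
  qed (simp add: indicator_fn_def)
next
  have "ereal (y \<bullet> x - f x) = ereal (y \<bullet> x) - (ereal (f x) + indicator_fn {x. A *v x = b} x)"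
    using feas by (simp add: indicator_fn_def)
  then show "ereal (y \<bullet> x - f x)
      \<le> (SUP x. ereal (y \<bullet> x) - (ereal (f x) + indicator_fn {x. A *v x = b} x))"
    by (simp only:) (rule SUP_upper, simp)
qed

text \<open>
  If \<open>x\<close> is the KKT point for \<open>y\<close> and \<open>z = K11 e\<close>, then \<open>x + z\<close> is the KKT point for \<open>y + e\<close>. Comparing
  the two values, the second-order part is \<open>e \<bullet> z - z \<bullet> H z / 2\<close>, which is \<open>e \<bullet> z / 2\<close>.
\<close>
lemma conjugate_exact_expansion:
  fixes A :: "real ^ 'n ^ 'm" and H :: "real ^ 'n ^ 'n"
  assumes H_psd: "pos_semidef H"
    and K: "invertible (block_matrix H (transpose A) A 0)"
      "K11 = block11 (matrix_inv (block_matrix H (transpose A) A 0))"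
    and f: "f = (\<lambda>x. 1/2 * (x \<bullet> (H *v x)) + \<zeta> \<bullet> x)"
    and F: "F = (\<lambda>x. ereal (f x) + indicator_fn {x. A *v x = b} x)"
  shows "\<exists>r x. \<forall>e. conjugate F (y + e) = ereal (r + x \<bullet> e + 1/2 * (e \<bullet> (K11 *v e)))"
proof -
  obtain x l where stat: "H *v x + \<zeta> + transpose A *v l = y" and feas: "A *v x = b"
    using KKT_point_exists[OF K(1)] by blast
  have "conjugate F (y + e) = ereal (y \<bullet> x - f x + x \<bullet> e + 1/2 * (e \<bullet> (K11 *v e)))" for e
  proof -
    define z where "z = K11 *v e"
    obtain \<mu> where \<mu>: "H *v z + transpose A *v \<mu> = e"
      using block11_KKT_inverse(1)[OF K] z_def by blast
    have Az: "A *v z = 0"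
      using block11_KKT_inverse(2)[OF K] by (simp add: z_def)
    have "H *v (x + z) + \<zeta> + transpose A *v (l + \<mu>)
        = (H *v x + \<zeta> + transpose A *v l) + (H *v z + transpose A *v \<mu>)"
      by (simp only: matrix_vector_right_distrib ac_simps)
    then have "H *v (x + z) + \<zeta> + transpose A *v (l + \<mu>) = y + e"
      by (simp only: stat \<mu>)
    moreover have "A *v (x + z) = b"
      by (simp add: matrix_vector_right_distrib feas Az)
    ultimately have "conjugate F (y + e) = ereal ((y + e) \<bullet> (x + z) - f (x + z))"
      unfolding F by (rule conjugate_eq_at_KKT_point[OF H_psd f])
    moreover have "y \<bullet> z = (H *v x + \<zeta>) \<bullet> z"
      by (simp add: inner_add_left inner_row_space_kernel[OF Az] flip: stat)
    moreover have "f (x + z) = f x + (H *v x + \<zeta>) \<bullet> z + 1/2 * (z \<bullet> (H *v z))"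
      unfolding f using H_psd by (intro quadratic_add) (simp add: pos_semidef_def)
    moreover have "z \<bullet> (H *v z) = e \<bullet> z"
      using block11_KKT_inverse_form[OF K, of e e] by (simp add: z_def inner_commute)
    ultimately show ?thesis
      by (simp add: inner_add_left inner_add_right inner_commute[of e x] flip: z_def)
  qed
  then show ?thesis by blast
qed

section \<open>Gradients of quadratics\<close>

lemma gradient_eqI:
  assumes "has_gradient g x D"
  shows "gradient g x = D"
  unfolding gradient_def
proof (rule the_equality)
  fix D' assume "has_gradient g x D'"
  then have "(\<lambda>v. v \<bullet> D') = (\<lambda>v. v \<bullet> D)"
    using assms by (auto simp: has_gradient_def gderiv_def intro: has_derivative_unique)
  then show "D' = D"
    by (metis vector_eq_ldot)
qed (rule assms)

lemma gradient_of_exact_quadratic: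
  fixes Q :: "real ^ 'k ^ 'k" and g :: "real ^ 'k \<Rightarrow> ereal"
  assumes g: "\<And>v. g (x + v) = ereal (r + D \<bullet> v - 1/2 * (v \<bullet> (Q *v v)))"
  shows "gradient g x = D"
proof -
  have g': "g = (\<lambda>y. ereal (r + D \<bullet> (y - x) - 1/2 * ((y - x) \<bullet> (Q *v (y - x)))))"
  proof
    fix y show "g y = ereal (r + D \<bullet> (y - x) - 1/2 * ((y - x) \<bullet> (Q *v (y - x))))"
      using g[of "y - x"] by simp
  qed
  have Q: "((\<lambda>y. Q *v (y - x)) has_derivative (\<lambda>v. Q *v v)) (at x)"
    by (auto intro!: derivative_eq_intros
        bounded_linear.has_derivative[OF matrix_vector_mul_bounded_linear])
  have "((\<lambda>y. r + D \<bullet> (y - x) - 1/2 * ((y - x) \<bullet> (Q *v (y - x))))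
      has_derivative (\<lambda>v. v \<bullet> D)) (at x)"
    by (rule derivative_eq_intros Q refl)+ (simp add: inner_commute)
  then have "has_gradient g x D"
    by (simp add: has_gradient_def gderiv_def g')
  then show ?thesis by (rule gradient_eqI)
qed

section \<open>The dual function\<close>

lemma inner_congruence:
  fixes C :: "real ^ 'n ^ 'k" and K :: "real ^ 'n ^ 'n"
  shows "u \<bullet> ((C ** K ** transpose C) *v v) = (transpose C *v u) \<bullet> (K *v (transpose C *v v))"
  by (simp add: dot_lmul_matrix flip: matrix_vector_mul_assoc)

lemma symmetric_matrix_congruence:
  fixes C :: "real ^ 'n ^ 'k" and K :: "real ^ 'n ^ 'n"
  assumes "symmetric_matrix K"
  shows "symmetric_matrix (C ** K ** transpose C)"
  using assms by (simp add: symmetric_matrix_def matrix_transpose_mul matrix_mul_assoc)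

lemma weighted_norm_sq_diff:
  fixes L M :: "real ^ 'k ^ 'k"
  shows "weighted_norm_sq (L - M) v = weighted_norm_sq L v - weighted_norm_sq M v"
  by (simp add: weighted_norm_sq_def matrix_vector_mult_diff_rdistrib inner_diff_right)

text \<open>
  A step \<open>v\<close> of \<open>\<nu>\<close> is a step \<open>- C\<^sup>T v\<close> of the argument of the conjugate, so the curvature \<open>K\<close> becomes
  \<open>C K C\<^sup>T\<close>. The linear coefficient at \<open>v\<close> is \<open>C x - c\<close>, the residual of the dualized constraints;
  by the exactness of the expansion it is the gradient.
\<close>
lemma dual_function_exact_expansion:
  fixes C :: "real ^ 'n ^ 'k" and K :: "real ^ 'n ^ 'n" and F :: "real ^ 'n \<Rightarrow> ereal"
  assumes conj: "\<And>y. \<exists>r x. \<forall>e. conjugate F (y + e) = ereal (r + x \<bullet> e + 1/2 * (e \<bullet> (K *v e)))"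
    and d: "d = (\<lambda>\<nu>. - conjugate F (- (transpose C *v \<nu>)) - ereal (c \<bullet> \<nu>))"
  shows "\<exists>r. d \<nu>' = ereal r \<and> d \<nu> = ereal (r + gradient d \<nu>' \<bullet> (\<nu> - \<nu>')
      - 1/2 * weighted_norm_sq (C ** K ** transpose C) (\<nu> - \<nu>'))"
proof -
  let ?G = "C ** K ** transpose C"
  obtain s x where sx: "\<And>e. conjugate F (- (transpose C *v \<nu>') + e)
      = ereal (s + x \<bullet> e + 1/2 * (e \<bullet> (K *v e)))"
    using conj by meson
  define r where "r = - s - c \<bullet> \<nu>'"
  have expand: "d (\<nu>' + v) = ereal (r + (C *v x - c) \<bullet> v - 1/2 * (v \<bullet> (?G *v v)))" for v
  proof -
    have "- (transpose C *v (\<nu>' + v)) = - (transpose C *v \<nu>') + - (transpose C *v v)"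
      by (simp add: matrix_vector_right_distrib)
    moreover have "x \<bullet> (transpose C *v v) = (C *v x) \<bullet> v"
      by (metis dot_lmul_matrix inner_commute transpose_matrix_vector)
    moreover have "K *v (- w) = - (K *v w)" for w
      by (metis diff_0 matrix_vector_mult_0_right matrix_vector_mult_diff_distrib)
    ultimately show ?thesis
      unfolding d inner_congruence
      by (simp only: sx) (simp add: r_def inner_diff_left inner_add_right algebra_simps)
  qed
  have "d \<nu>' = ereal r"
    using expand[of 0] by simp
  moreover have "d \<nu> = ereal (r + gradient d \<nu>' \<bullet> (\<nu> - \<nu>') - 1/2 * weighted_norm_sq ?G (\<nu> - \<nu>'))"
    using expand[of "\<nu> - \<nu>'"]
    by (simp add: gradient_of_exact_quadratic[OF expand] weighted_norm_sq_def)
  ultimately show ?thesis by blast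
qed

theorem proposition15:
  fixes A :: "real ^ 'n ^ 'm" and B :: "real ^ 'n ^ 'p" and b :: "real ^ 'm"
    and H :: "real ^ 'n ^ 'n" and \<zeta> :: "real ^ 'n"
    and f :: "real ^ 'n \<Rightarrow> real" and h F :: "real ^ 'n \<Rightarrow> ereal"
    and C :: "real ^ 'n ^ ('m + 'p)" and c :: "real ^ ('m + 'p)"
    and d :: "real ^ ('m + 'p) \<Rightarrow> ereal"
    and K11 :: "real ^ 'n ^ 'n"
  assumes A_rank: "rank A = CARD('m)"
    and H_psd: "pos_semidef H"
    and H_pd: "\<And>x. x \<noteq> 0 \<Longrightarrow> A *v x = 0 \<Longrightarrow> x \<bullet> (H *v x) > 0"
    and f: "f = (\<lambda>x. 1/2 * (x \<bullet> (H *v x)) + \<zeta> \<bullet> x)"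
    and h: "h = indicator_fn {x. A *v x = b}"
    and F: "F = (\<lambda>x. ereal (f x) + h x)"
    and C: "C = vcat A B"
    and c: "c = vcat b 0"
    and d: "d = (\<lambda>\<nu>. - conjugate F (- (transpose C *v \<nu>)) - ereal (c \<bullet> \<nu>))"
    and K11: "K11 = block11 (matrix_inv (block_matrix H (transpose A) A 0))"
  shows
    "(\<forall>L. pos_semidef L \<and> L \<succeq> C ** K11 ** transpose C \<longrightarrow>
        (\<forall>\<nu>1 \<nu>2. d \<nu>1 \<ge> d \<nu>2 + ereal (gradient d \<nu>2 \<bullet> (\<nu>1 - \<nu>2))
                             - ereal (1/2 * weighted_norm_sq L (\<nu>1 - \<nu>2)))) \<and>
     (\<forall>L. symmetric_matrix L \<and> \<not> (L \<succeq> C ** K11 ** transpose C) \<longrightarrow>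
        (\<exists>\<nu>1 \<nu>2. \<not> (d \<nu>1 \<ge> d \<nu>2 + ereal (gradient d \<nu>2 \<bullet> (\<nu>1 - \<nu>2))
                             - ereal (1/2 * weighted_norm_sq L (\<nu>1 - \<nu>2)))))"
proof -
  let ?G = "C ** K11 ** transpose C"
  have inv: "invertible (block_matrix H (transpose A) A 0)"
    using KKT_matrix_invertible[OF A_rank H_pd] .
  have F': "F = (\<lambda>x. ereal (f x) + indicator_fn {x. A *v x = b} x)"
    by (simp add: F h)
  have bound_iff: "d \<nu>1 \<ge> d \<nu>2 + ereal (gradient d \<nu>2 \<bullet> (\<nu>1 - \<nu>2))
        - ereal (1/2 * weighted_norm_sq L (\<nu>1 - \<nu>2))
      \<longleftrightarrow> 0 \<le> weighted_norm_sq (L - ?G) (\<nu>1 - \<nu>2)" for L \<nu>1 \<nu>2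
    using dual_function_exact_expansion[OF conjugate_exact_expansion[OF H_psd inv K11 f F'] d,
        of \<nu>2 \<nu>1]
    by (auto simp: weighted_norm_sq_diff)
  have G_sym: "symmetric_matrix ?G"
    using H_psd block11_KKT_inverse_symmetric[OF _ inv K11]
    by (simp add: pos_semidef_def symmetric_matrix_congruence)
  have loewner_iff: "L \<succeq> ?G \<longleftrightarrow> (\<forall>v. 0 \<le> weighted_norm_sq (L - ?G) v)"
    if "symmetric_matrix L" for L
    using that G_sym
    by (simp add: loewner_ge_def pos_semidef_def weighted_norm_sq_def symmetric_matrix_iff_inner
        matrix_vector_mult_diff_rdistrib inner_diff_left inner_diff_right)
  show ?thesis
    unfolding bound_iff
  proof (intro conjI allI impI)
    fix L \<nu>1 \<nu>2
    assume "pos_semidef L \<and> L \<succeq> ?G"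
    then show "0 \<le> weighted_norm_sq (L - ?G) (\<nu>1 - \<nu>2)"
      by (simp add: loewner_ge_def pos_semidef_def weighted_norm_sq_def)
  next
    fix L
    assume "symmetric_matrix L \<and> \<not> L \<succeq> ?G"
    then obtain v where "\<not> 0 \<le> weighted_norm_sq (L - ?G) (v - 0)"
      using loewner_iff by auto
    then show "\<exists>\<nu>1 \<nu>2. \<not> 0 \<le> weighted_norm_sq (L - ?G) (\<nu>1 - \<nu>2)"
      by blast
  qed
qed

end
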